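(* For every integer $r\ge1$, the Hausdorff dimension of the closed subgroup $G(r)\subset W$ exists and is equal to $1-2^{-r}$; that is, $$\lim_{n\to\infty}\frac{\log_2|G(r)_n|}{2^n-1}=1-2^{-r}.$$
   Context: Tree: $T$ is the regular rooted binary tree whose vertices are the finite words over $\{0,1\}$ (root = empty word; the children of $t$ are $t0,t1$). $W=\mathrm{Aut}(T)$ is the profinite group of automorphisms of $T$ fixing the root. $T_n$ is the truncation of $T$ at level $n$ (vertices of level $\le n$), and $W_n=\mathrm{Aut}(T_n)$, a group of order $2^{2^n-1}$. For a subgroup $X\subset W$, $X_n$ denotes its image in $W_n$. The Hausdorff dimension of a closed subgroup $X\subset W$ is by definition $\lim_{n\to\infty}\log_2|X_n|/(2^n-1)$, if this limit exists. Identifying the subtrees below the vertices $0$ and $1$ with $T$ gives $W=(W\times W)\rtimes\langle\sigma\rangle$, where $(u,v)$ acts by $u$ on the first and by $v$ on the second subtree, and $\sigma$ is the involution interchanging the two subtrees, so $\sigma(u,v)=(v,u)\sigma$. The group $G(r)$: for an integer $r\ge1$, define elements $a_i$ ($i\ge1$) and $b_j$ ($1\le j\le r$) of $W$ as the unique elements satisfying the recursion relations $a_1=\sigma$; $a_{r+1}=(a_r,b_r)$; $a_i=(a_{i-1},1)$ for all $i>1$ with $i\ne r+1$; $b_1=(b_r,b_r^{-1})\sigma$; $b_j=(b_rb_{j-1}b_r^{-1},1)$ for all $1<j\le r$. (Such relations determine unique elements of $W$, level by level.) $G(r)$ is the closure in $W$ of the subgroup generated by all $a_i$ and $b_j$.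 *)

theory Defs
  imports "HOL-Analysis.Analysis" "HOL-Algebra.Generated_Groups"
begin

text \<open>Words over $\{0,1\}$, with \<open>False\<close> for $0$ and \<open>True\<close> for $1$; the head of the list is the
  first letter, so the children of a vertex \<open>t\<close> are \<open>t @ [False]\<close> and \<open>t @ [True]\<close>.\<close>

type_synonym word = "bool list"

definition tree_adj :: "word \<Rightarrow> word \<Rightarrow> bool" where
  "tree_adj s t \<longleftrightarrow> (\<exists>x. t = s @ [x]) \<or> (\<exists>x. s = t @ [x])"

text \<open>Root-fixing graph automorphisms of the subtree with vertex set \<open>V\<close>. Outside \<open>V\<close> they are
  normalised to \<open>undefined\<close> so that they can be counted.\<close>

definition tree_aut :: "word set \<Rightarrow> (word \<Rightarrow> word) set" where
  "tree_aut V = {g \<in> extensional V. bij_betw g V V \<and> g [] = [] \<and>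
     (\<forall>s\<in>V. \<forall>t\<in>V. tree_adj (g s) (g t) \<longleftrightarrow> tree_adj s t)}"

definition trunc_tree :: "nat \<Rightarrow> word set" where
  "trunc_tree n = {t. length t \<le> n}"

text \<open>Automorphisms act from the left: \<open>g \<otimes> h\<close> is first \<open>h\<close>, then \<open>g\<close>.\<close>

definition W :: "(word \<Rightarrow> word) monoid" where
  "W = \<lparr>carrier = tree_aut UNIV, mult = (\<circ>), one = id\<rparr>"

definition W_proj :: "nat \<Rightarrow> (word \<Rightarrow> word) \<Rightarrow> (word \<Rightarrow> word)" where
  "W_proj n g = restrict g (trunc_tree n)"

text \<open>The profinite topology: the coarsest one making every projection from \<open>W\<close> to the discrete
  group \<open>tree_aut (trunc_tree n)\<close> continuous.\<close>

definition W_topology :: "(word \<Rightarrow> word) topology" where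
  "W_topology = topology_generated_by
     {{g \<in> carrier W. W_proj n g \<in> U} | n U. U \<subseteq> tree_aut (trunc_tree n)}"

definition has_hausdorff_dim :: "(word \<Rightarrow> word) set \<Rightarrow> real \<Rightarrow> bool" where
  "has_hausdorff_dim X d \<longleftrightarrow>
     (\<lambda>n. log 2 (real (card (W_proj n ` X))) / (2 ^ n - 1)) \<longlonglongrightarrow> d"

definition tree_swap :: "word \<Rightarrow> word" where
  "tree_swap t = (case t of [] \<Rightarrow> [] | x # s \<Rightarrow> (\<not> x) # s)"

definition tpair :: "(word \<Rightarrow> word) \<Rightarrow> (word \<Rightarrow> word) \<Rightarrow> (word \<Rightarrow> word)" where
  "tpair u v t = (case t of [] \<Rightarrow> [] | x # s \<Rightarrow> if x then True # v s else False # u s)"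

text \<open>The families are \<open>undefined\<close> outside the index ranges $i \geq 1$ and $1 \leq j \leq r$, so that
  the relations determine them uniquely as functions.\<close>

definition recursion_relations ::
  "nat \<Rightarrow> (nat \<Rightarrow> word \<Rightarrow> word) \<Rightarrow> (nat \<Rightarrow> word \<Rightarrow> word) \<Rightarrow> bool" where
  "recursion_relations r a b \<longleftrightarrow>
     a \<in> {1..} \<rightarrow>\<^sub>E carrier W \<and> b \<in> {1..r} \<rightarrow>\<^sub>E carrier W \<and>
     a 1 = tree_swap \<and>
     a (r + 1) = tpair (a r) (b r) \<and>
     (\<forall>i>1. i \<noteq> r + 1 \<longrightarrow> a i = tpair (a (i - 1)) \<one>\<^bsub>W\<^esub>) \<and>
     b 1 = tpair (b r) (inv\<^bsub>W\<^esub> (b r)) \<otimes>\<^bsub>W\<^esub> tree_swap \<and>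
     (\<forall>j. 1 < j \<and> j \<le> r \<longrightarrow>
        b j = tpair (b r \<otimes>\<^bsub>W\<^esub> b (j - 1) \<otimes>\<^bsub>W\<^esub> inv\<^bsub>W\<^esub> (b r)) \<one>\<^bsub>W\<^esub>)"

text \<open>Existence and uniqueness for $r \geq 1$ are shown in \<open>recursion_relations_ex1\<close> below.\<close>

definition gens :: "nat \<Rightarrow> (nat \<Rightarrow> word \<Rightarrow> word) \<times> (nat \<Rightarrow> word \<Rightarrow> word)" where
  "gens r = (THE p. recursion_relations r (fst p) (snd p))"

definition gen_a :: "nat \<Rightarrow> nat \<Rightarrow> word \<Rightarrow> word" where
  "gen_a r = fst (gens r)"

definition gen_b :: "nat \<Rightarrow> nat \<Rightarrow> word \<Rightarrow> word" where
  "gen_b r = snd (gens r)"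

definition G :: "nat \<Rightarrow> (word \<Rightarrow> word) set" where
  "G r = Abstract_Topology.closure_of W_topology (generate W (gen_a r ` {1..} \<union> gen_b r ` {1..r}))"

lemma carrier_W_iff:
  "g \<in> carrier W \<longleftrightarrow> bij g \<and> g [] = [] \<and> (\<forall>s t. tree_adj (g s) (g t) \<longleftrightarrow> tree_adj s t)"
  by (auto simp: W_def tree_aut_def)

lemma mult_W [simp]: "g \<otimes>\<^bsub>W\<^esub> h = g \<circ> h"
  and one_W [simp]: "\<one>\<^bsub>W\<^esub> = id"
  by (simp_all add: W_def)

lemma id_in_W [simp]: "id \<in> carrier W"
  by (simp add: carrier_W_iff)

lemma comp_in_W: "g \<in> carrier W \<Longrightarrow> h \<in> carrier W \<Longrightarrow> g \<circ> h \<in> carrier W"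
  by (simp add: carrier_W_iff bij_comp)

lemma inv_in_W:
  assumes "g \<in> carrier W" shows "inv_into UNIV g \<in> carrier W"
proof -
  have b: "bij g" "g [] = []" and e: "\<And>s t. tree_adj (g s) (g t) \<longleftrightarrow> tree_adj s t"
    using assms by (auto simp: carrier_W_iff)
  have "tree_adj (inv_into UNIV g s) (inv_into UNIV g t) \<longleftrightarrow> tree_adj s t" for s t
    using e[of "inv_into UNIV g s" "inv_into UNIV g t"] b(1)
    by (simp add: bij_is_surj surj_f_inv_f)
  moreover have "inv_into UNIV g [] = []"
    using b by (metis bij_is_inj inv_f_f)
  ultimately show ?thesis
    using b bij_imp_bij_inv by (auto simp: carrier_W_iff)
qed

lemma group_W: "group W"
proof (rule groupI)
  fix g assume g: "g \<in> carrier W"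
  then have "inv_into UNIV g \<circ> g = id"
    by (simp add: carrier_W_iff bij_is_inj)
  with g show "\<exists>h\<in>carrier W. h \<otimes>\<^bsub>W\<^esub> g = \<one>\<^bsub>W\<^esub>"
    using inv_in_W by auto
qed (auto simp: comp_in_W[simplified] comp_assoc)

lemma inv_W: "g \<in> carrier W \<Longrightarrow> inv\<^bsub>W\<^esub> g = inv_into UNIV g"
  by (rule group.inv_equality[OF group_W])
    (auto simp: inv_in_W, auto simp: carrier_W_iff bij_is_inj)

lemma length_W:
  assumes "g \<in> carrier W" shows "length (g t) = length t"
proof (induction "length t" arbitrary: t rule: less_induct)
  case less
  have b: "inj g" "g [] = []" and e: "\<And>s t. tree_adj (g s) (g t) \<longleftrightarrow> tree_adj s t"
    using assms by (auto simp: carrier_W_iff bij_is_inj)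
  show ?case
  proof (cases t rule: rev_cases)
    case Nil then show ?thesis using b by simp
  next
    case (snoc s x)
    have ls: "length (g s) = length s" using less[of s] snoc by simp
    have ad: "tree_adj (g s) (g t)" unfolding e using snoc by (auto simp: tree_adj_def)
    show ?thesis
    proof (cases "\<exists>y. g t = g s @ [y]")
      case True then show ?thesis using ls snoc by auto
    next
      case False
      then obtain y where y: "g s = g t @ [y]" using ad by (auto simp: tree_adj_def)
      then have "s \<noteq> []" using b by auto
      then obtain u z where u: "s = u @ [z]" by (cases s rule: rev_cases) auto
      have lu: "length (g u) = length u" using less[of u] snoc u by simp
      have "tree_adj (g u) (g s)" unfolding e using u by (auto simp: tree_adj_def)
      then have "g u = g t" using y lu ls u by (auto simp: tree_adj_def)
      then have "u = t" using b by (simp add: inj_eq)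
      then show ?thesis using u snoc by simp
    qed
  qed
qed

lemma tree_adj_simps [simp]:
  "tree_adj (x # s) (y # t) \<longleftrightarrow> x = y \<and> tree_adj s t"
  "tree_adj [] (y # t) \<longleftrightarrow> t = []"
  "tree_adj (y # t) [] \<longleftrightarrow> t = []"
  "\<not> tree_adj [] []"
  by (auto simp: tree_adj_def)

lemma tree_swap_simps [simp]: "tree_swap [] = []" "tree_swap (x # s) = (\<not> x) # s"
  by (simp_all add: tree_swap_def)

lemma tpair_simps [simp]:
  "tpair u v [] = []" "tpair u v (x # s) = x # (if x then v s else u s)"
  by (simp_all add: tpair_def)

lemma tree_swap_in_W [simp]: "tree_swap \<in> carrier W"
proof -
  have "tree_swap (tree_swap t) = t" for t by (cases t) auto
  then have "bij tree_swap" by (metis involuntory_imp_bij)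
  moreover have "tree_adj (tree_swap s) (tree_swap t) \<longleftrightarrow> tree_adj s t" for s t
    by (cases s; cases t) auto
  ultimately show ?thesis by (simp add: carrier_W_iff)
qed

lemma tpair_in_W [simp]:
  assumes "u \<in> carrier W" "v \<in> carrier W" shows "tpair u v \<in> carrier W"
proof -
  have u: "bij u" "\<And>s t. tree_adj (u s) (u t) \<longleftrightarrow> tree_adj s t" "\<And>s. u s = [] \<longleftrightarrow> s = []"
    using assms length_W[of u] by (auto simp: carrier_W_iff simp flip: length_0_conv)
  have v: "bij v" "\<And>s t. tree_adj (v s) (v t) \<longleftrightarrow> tree_adj s t" "\<And>s. v s = [] \<longleftrightarrow> s = []"
    using assms length_W[of v] by (auto simp: carrier_W_iff simp flip: length_0_conv)
  have "bij (tpair u v)"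
  proof (rule o_bij[where g = "tpair (inv_into UNIV u) (inv_into UNIV v)"])
    show "tpair (inv_into UNIV u) (inv_into UNIV v) \<circ> tpair u v = id"
    proof
      fix t show "(tpair (inv_into UNIV u) (inv_into UNIV v) \<circ> tpair u v) t = id t"
        using u(1) v(1) by (cases t) (auto simp: bij_is_inj)
    qed
    show "tpair u v \<circ> tpair (inv_into UNIV u) (inv_into UNIV v) = id"
    proof
      fix t show "(tpair u v \<circ> tpair (inv_into UNIV u) (inv_into UNIV v)) t = id t"
        using u(1) v(1) by (cases t) (auto simp: bij_is_surj surj_f_inv_f)
    qed
  qed
  moreover have "tree_adj (tpair u v s) (tpair u v t) \<longleftrightarrow> tree_adj s t" for s t
    using u v by (cases s; cases t) auto
  ultimately show ?thesis by (simp add: carrier_W_iff)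
qed

definition agree :: "nat \<Rightarrow> (word \<Rightarrow> word) \<Rightarrow> (word \<Rightarrow> word) \<Rightarrow> bool" where
  "agree n g h \<longleftrightarrow> (\<forall>t. length t \<le> n \<longrightarrow> g t = h t)"

lemma agree_refl [simp]: "agree n g g"
  by (simp add: agree_def)

lemma agree_comp:
  assumes "agree n g g'" "agree n h h'" "h \<in> carrier W"
  shows "agree n (g \<circ> h) (g' \<circ> h')"
  using assms length_W[of h] unfolding agree_def by (metis comp_apply)

lemma agree_inv:
  assumes "agree n g h" "g \<in> carrier W" "h \<in> carrier W"
  shows "agree n (inv\<^bsub>W\<^esub> g) (inv\<^bsub>W\<^esub> h)"
  unfolding agree_def
proof (intro allI impI)
  fix t :: word assume t: "length t \<le> n"
  have bij: "bij g" "bij h" using assms by (auto simp: carrier_W_iff)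
  have "length (inv_into UNIV g t) \<le> n"
    using t length_W[OF inv_in_W[OF assms(2)]] by simp
  then have "h (inv_into UNIV g t) = g (inv_into UNIV g t)"
    using assms(1) by (simp add: agree_def)
  also have "\<dots> = t" using bij by (simp add: bij_is_surj surj_f_inv_f)
  finally have "inv_into UNIV h t = inv_into UNIV g t"
    using bij by (metis bij_is_inj inv_f_f)
  then show "(inv\<^bsub>W\<^esub> g) t = (inv\<^bsub>W\<^esub> h) t" using assms by (simp add: inv_W)
qed

lemma agree_tpair:
  assumes "agree n u u'" "agree n v v'" shows "agree (Suc n) (tpair u v) (tpair u' v')"
  unfolding agree_def
proof (intro allI impI)
  fix t :: word assume "length t \<le> Suc n"
  then show "tpair u v t = tpair u' v' t"
    using assms by (cases t) (auto simp: agree_def)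
qed

lemma agree_all: "(\<And>n. agree n g h) \<Longrightarrow> g = h"
  by (auto simp: agree_def fun_eq_iff)

lemma W_limit:
  assumes "\<And>n. \<exists>h\<in>carrier W. agree n g h" shows "g \<in> carrier W"
proof -
  have ex: "\<exists>h\<in>carrier W. g s = h s \<and> g t = h t" for s t
    using assms[of "max (length s) (length t)"] by (auto simp: agree_def)
  have "inj g"
  proof (rule injI)
    fix s t assume "g s = g t"
    then show "s = t" using ex[of s t] by (auto simp: carrier_W_iff bij_is_inj inj_eq)
  qed
  moreover have "t \<in> range g" for t
  proof -
    obtain h where h: "h \<in> carrier W" "agree (length t) g h" using assms by blast
    then have "g (inv_into UNIV h t) = h (inv_into UNIV h t)"
      using length_W[OF inv_in_W[OF h(1)]] by (simp add: agree_def)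
    also have "\<dots> = t" using h(1) by (simp add: carrier_W_iff bij_is_surj surj_f_inv_f)
    finally show ?thesis by (metis rangeI)
  qed
  moreover have "g [] = []" using ex[of "[]" "[]"] by (auto simp: carrier_W_iff)
  moreover have "tree_adj (g s) (g t) \<longleftrightarrow> tree_adj s t" for s t
    using ex[of s t] by (auto simp: carrier_W_iff)
  ultimately show ?thesis by (auto simp: carrier_W_iff bij_def)
qed

definition step_a :: "nat \<Rightarrow> (nat \<Rightarrow> word \<Rightarrow> word) \<Rightarrow> (nat \<Rightarrow> word \<Rightarrow> word) \<Rightarrow> nat \<Rightarrow> word \<Rightarrow> word" where
  "step_a r a b = (\<lambda>i\<in>{1..}. if i = 1 then tree_swap else if i = r + 1 then tpair (a r) (b r)
     else tpair (a (i - 1)) \<one>\<^bsub>W\<^esub>)"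

definition step_b :: "nat \<Rightarrow> (nat \<Rightarrow> word \<Rightarrow> word) \<Rightarrow> nat \<Rightarrow> word \<Rightarrow> word" where
  "step_b r b = (\<lambda>j\<in>{1..r}. if j = 1 then tpair (b r) (inv\<^bsub>W\<^esub> (b r)) \<otimes>\<^bsub>W\<^esub> tree_swap
     else tpair (b r \<otimes>\<^bsub>W\<^esub> b (j - 1) \<otimes>\<^bsub>W\<^esub> inv\<^bsub>W\<^esub> (b r)) \<one>\<^bsub>W\<^esub>)"

lemma recursion_relations_iff:
  assumes "r \<ge> 1"
  shows "recursion_relations r a b \<longleftrightarrow>
    a \<in> {1..} \<rightarrow>\<^sub>E carrier W \<and> b \<in> {1..r} \<rightarrow>\<^sub>E carrier W \<and> a = step_a r a b \<and> b = step_b r b"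
    (is "?L \<longleftrightarrow> ?R")
proof
  assume L: ?L
  then have ab: "a \<in> {1..} \<rightarrow>\<^sub>E carrier W" "b \<in> {1..r} \<rightarrow>\<^sub>E carrier W"
    by (auto simp: recursion_relations_def)
  have "a i = step_a r a b i" for i
  proof (cases "i \<ge> 1")
    case True
    then have "i = 1 \<or> i = r + 1 \<or> (i > 1 \<and> i \<noteq> r + 1)" by auto
    then show ?thesis using L assms unfolding recursion_relations_def step_a_def by auto
  next
    case False
    then show ?thesis using PiE_arb[OF ab(1)] by (auto simp: step_a_def)
  qed
  moreover have "b j = step_b r b j" for j
  proof (cases "j \<in> {1..r}")
    case True
    show ?thesis
    proof (cases "j = 1")
      case j: True
      have "b 1 = tpair (b r) (inv\<^bsub>W\<^esub> (b r)) \<otimes>\<^bsub>W\<^esub> tree_swap"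
        using L unfolding recursion_relations_def by blast
      also have "\<dots> = step_b r b 1" using assms by (simp add: step_b_def)
      finally show ?thesis using j by blast
    next
      case j: False
      have "b j = tpair (b r \<otimes>\<^bsub>W\<^esub> b (j - 1) \<otimes>\<^bsub>W\<^esub> inv\<^bsub>W\<^esub> (b r)) \<one>\<^bsub>W\<^esub>"
        using L True j unfolding recursion_relations_def
        by (metis atLeastAtMost_iff le_neq_implies_less)
      also have "\<dots> = step_b r b j" using True j by (simp add: step_b_def)
      finally show ?thesis .
    qed
  next
    case False
    then show ?thesis using PiE_arb[OF ab(2)] unfolding step_b_def by auto
  qed
  ultimately show ?R using ab by blast
next
  assume R: ?R
  then have a: "a i = step_a r a b i" and b: "b i = step_b r b i" for i
    by (blast intro: fun_cong)+
  have "a 1 = tree_swap" by (subst a) (simp add: step_a_def)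
  moreover have "a (r + 1) = tpair (a r) (b r)"
    by (subst a) (use assms in \<open>simp add: step_a_def\<close>)
  moreover have "a i = tpair (a (i - 1)) \<one>\<^bsub>W\<^esub>" if "i > 1" "i \<noteq> r + 1" for i
    by (subst a) (use that in \<open>simp add: step_a_def\<close>)
  moreover have "b 1 = tpair (b r) (inv\<^bsub>W\<^esub> (b r)) \<otimes>\<^bsub>W\<^esub> tree_swap"
    by (subst b) (use assms in \<open>simp add: step_b_def\<close>)
  moreover have "b j = tpair (b r \<otimes>\<^bsub>W\<^esub> b (j - 1) \<otimes>\<^bsub>W\<^esub> inv\<^bsub>W\<^esub> (b r)) \<one>\<^bsub>W\<^esub>" if "1 < j \<and> j \<le> r" for j
    by (subst b) (use that in \<open>simp add: step_b_def\<close>)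
  ultimately show ?L using R unfolding recursion_relations_def by blast
qed

lemma step_in:
  assumes "r \<ge> 1" "a \<in> {1..} \<rightarrow>\<^sub>E carrier W" "b \<in> {1..r} \<rightarrow>\<^sub>E carrier W"
  shows "step_a r a b \<in> {1..} \<rightarrow>\<^sub>E carrier W" "step_b r b \<in> {1..r} \<rightarrow>\<^sub>E carrier W"
proof -
  have a: "a i \<in> carrier W" if "i \<ge> 1" for i using assms(2) that by auto
  have b: "b i \<in> carrier W" if "i \<ge> 1" "i \<le> r" for i using assms(3) that by auto
  have i: "inv\<^bsub>W\<^esub> (b r) \<in> carrier W" using b assms(1) inv_W inv_in_W by simp
  show "step_a r a b \<in> {1..} \<rightarrow>\<^sub>E carrier W"
    unfolding step_a_def by (rule restrict_PiE_iff[THEN iffD2]) (use a b assms(1) in auto)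
  show "step_b r b \<in> {1..r} \<rightarrow>\<^sub>E carrier W"
    unfolding step_b_def
    by (rule restrict_PiE_iff[THEN iffD2])
      (use i b assms(1) in \<open>auto intro!: comp_in_W tpair_in_W\<close>)
qed

lemma step_agree:
  assumes "r \<ge> 1" "a \<in> {1..} \<rightarrow>\<^sub>E carrier W" "b \<in> {1..r} \<rightarrow>\<^sub>E carrier W"
    "a' \<in> {1..} \<rightarrow>\<^sub>E carrier W" "b' \<in> {1..r} \<rightarrow>\<^sub>E carrier W"
    "\<And>i. agree n (a i) (a' i)" "\<And>i. agree n (b i) (b' i)"
  shows "agree (Suc n) (step_a r a b i) (step_a r a' b' i)"
    "agree (Suc n) (step_b r b i) (step_b r b' i)"
proof -
  have b: "b i \<in> carrier W" "b' i \<in> carrier W" if "i \<ge> 1" "i \<le> r" for i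
    using assms(3,5) that by auto
  have i: "inv\<^bsub>W\<^esub> (b r) \<in> carrier W" "inv\<^bsub>W\<^esub> (b' r) \<in> carrier W"
    using b assms(1) inv_W inv_in_W by simp_all
  have ai: "agree n (inv\<^bsub>W\<^esub> (b r)) (inv\<^bsub>W\<^esub> (b' r))"
    using agree_inv assms(1,7) b by simp
  show "agree (Suc n) (step_a r a b i) (step_a r a' b' i)"
    using assms(6,7) by (auto simp: step_a_def agree_tpair)
  show "agree (Suc n) (step_b r b i) (step_b r b' i)"
    using assms(1,7) ai i b
    by (auto simp: step_b_def intro!: agree_tpair agree_comp comp_in_W)
qed

primrec approx :: "nat \<Rightarrow> nat \<Rightarrow> (nat \<Rightarrow> word \<Rightarrow> word) \<times> (nat \<Rightarrow> word \<Rightarrow> word)" where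
  "approx r 0 = (\<lambda>i\<in>{1..}. id, \<lambda>j\<in>{1..r}. id)"
| "approx r (Suc n) = (step_a r (fst (approx r n)) (snd (approx r n)), step_b r (snd (approx r n)))"

lemma approx_in:
  assumes "r \<ge> 1"
  shows "fst (approx r n) \<in> {1..} \<rightarrow>\<^sub>E carrier W \<and> snd (approx r n) \<in> {1..r} \<rightarrow>\<^sub>E carrier W"
proof (induction n)
  case 0
  show ?case unfolding approx.simps fst_conv snd_conv by (intro conjI restrict_PiE_iff[THEN iffD2] ballI id_in_W)
next
  case (Suc n)
  then show ?case unfolding approx.simps fst_conv snd_conv
    using step_in[OF assms, of "fst (approx r n)" "snd (approx r n)"] by blast
qed

lemma agree_0: "g \<in> carrier W \<Longrightarrow> h \<in> carrier W \<Longrightarrow> agree 0 g h"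
  by (auto simp: agree_def carrier_W_iff)

lemma agree_0_PiE: "a \<in> A \<rightarrow>\<^sub>E carrier W \<Longrightarrow> a' \<in> A \<rightarrow>\<^sub>E carrier W \<Longrightarrow> agree 0 (a i) (a' i)"
  using PiE_mem[of a A _ i] PiE_mem[of a' A _ i] PiE_arb[of a A _ i] PiE_arb[of a' A _ i]
  by (cases "i \<in> A") (metis agree_0, metis agree_refl)

lemma approx_agree_Suc:
  assumes "r \<ge> 1"
  shows "(\<forall>i. agree n (fst (approx r n) i) (fst (approx r (Suc n)) i)) \<and>
    (\<forall>i. agree n (snd (approx r n) i) (snd (approx r (Suc n)) i))"
proof (induction n)
  case 0
  show ?case
    using agree_0_PiE[OF approx_in[OF assms, of 0, THEN conjunct1]
        approx_in[OF assms, of "Suc 0", THEN conjunct1]]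
      agree_0_PiE[OF approx_in[OF assms, of 0, THEN conjunct2]
        approx_in[OF assms, of "Suc 0", THEN conjunct2]]
    by blast
next
  case (Suc n)
  define a b a' b' where "a = fst (approx r n)" "b = snd (approx r n)"
    "a' = fst (approx r (Suc n))" "b' = snd (approx r (Suc n))"
  note d = this
  have "fst (approx r (Suc n)) = step_a r a b" "snd (approx r (Suc n)) = step_b r b"
    "fst (approx r (Suc (Suc n))) = step_a r a' b'" "snd (approx r (Suc (Suc n))) = step_b r b'"
    by (simp_all add: d)
  moreover have "a \<in> {1..} \<rightarrow>\<^sub>E carrier W" "b \<in> {1..r} \<rightarrow>\<^sub>E carrier W"
    "a' \<in> {1..} \<rightarrow>\<^sub>E carrier W" "b' \<in> {1..r} \<rightarrow>\<^sub>E carrier W"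
    unfolding d using approx_in[OF assms, of n] approx_in[OF assms, of "Suc n"] by blast+
  note st = step_agree[OF assms this]
  have "agree n (a i) (a' i)" "agree n (b i) (b' i)" for i
    unfolding d using Suc by blast+
  note st[OF this]
  ultimately show ?case by presburger
qed

lemma approx_agree:
  assumes "r \<ge> 1" "n \<le> m"
  shows "agree n (fst (approx r n) i) (fst (approx r m) i) \<and>
    agree n (snd (approx r n) i) (snd (approx r m) i)"
  using assms(2)
proof (induction m rule: dec_induct)
  case base
  show ?case by simp
next
  case (step m)
  have "agree m (fst (approx r m) i) (fst (approx r (Suc m)) i)"
    "agree m (snd (approx r m) i) (snd (approx r (Suc m)) i)"
    using approx_agree_Suc[OF assms(1), of m] by blast+
  then show ?case using step.IH \<open>n \<le> m\<close> by (simp add: agree_def del: approx.simps)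
qed

lemma recursion_relations_unique:
  assumes "r \<ge> 1" "recursion_relations r a b" "recursion_relations r a' b'"
  shows "a = a' \<and> b = b'"
proof -
  have ab: "a \<in> {1..} \<rightarrow>\<^sub>E carrier W" "b \<in> {1..r} \<rightarrow>\<^sub>E carrier W"
    "a' \<in> {1..} \<rightarrow>\<^sub>E carrier W" "b' \<in> {1..r} \<rightarrow>\<^sub>E carrier W"
    and s: "a = step_a r a b" "b = step_b r b" "a' = step_a r a' b'" "b' = step_b r b'"
    using assms recursion_relations_iff by blast+
  have "(\<forall>i. agree n (a i) (a' i)) \<and> (\<forall>i. agree n (b i) (b' i))" for n
  proof (induction n)
    case 0
    show ?case using agree_0_PiE[OF ab(1,3)] agree_0_PiE[OF ab(2,4)] by blast
  next
    case (Suc n)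
    then have "agree n (a i) (a' i)" "agree n (b i) (b' i)" for i by blast+
    from step_agree[OF assms(1) ab this] show ?case
      unfolding s[symmetric] by blast
  qed
  then show ?thesis by (meson agree_all ext)
qed

lemma recursion_relations_exists:
  assumes r: "r \<ge> 1"
  shows "\<exists>a b. recursion_relations r a b"
proof -
  define a where "a = (\<lambda>i\<in>{1..}. \<lambda>t. fst (approx r (length t)) i t)"
  define b where "b = (\<lambda>j\<in>{1..r}. \<lambda>t. snd (approx r (length t)) j t)"
  have aa: "agree n (a i) (fst (approx r n) i)" for n i
  proof (cases "i \<ge> 1")
    case True
    then show ?thesis using approx_agree[OF r] unfolding a_def agree_def by simp
  next
    case False
    then have "fst (approx r n) i = undefined"
      using PiE_arb[OF approx_in[OF r, THEN conjunct1]] by simp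
    then show ?thesis using False by (simp add: a_def)
  qed
  have bb: "agree n (b i) (snd (approx r n) i)" for n i
  proof (cases "i \<in> {1..r}")
    case True
    then show ?thesis using approx_agree[OF r] unfolding b_def agree_def by simp
  next
    case False
    then have "snd (approx r n) i = undefined"
      using PiE_arb[OF approx_in[OF r, THEN conjunct2]] by simp
    then show ?thesis using False by (auto simp add: b_def)
  qed
  have aW: "a \<in> {1..} \<rightarrow>\<^sub>E carrier W"
  proof (rule PiE_I)
    fix i :: nat assume i: "i \<in> {1..}"
    show "a i \<in> carrier W"
    proof (rule W_limit)
      fix n
      have "fst (approx r n) i \<in> carrier W" using approx_in[OF r, of n] i by blast
      then show "\<exists>h\<in>carrier W. agree n (a i) h" using aa by blast
    qed
  qed (simp add: a_def)
  have bW: "b \<in> {1..r} \<rightarrow>\<^sub>E carrier W"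
  proof (rule PiE_I)
    fix i :: nat assume i: "i \<in> {1..r}"
    show "b i \<in> carrier W"
    proof (rule W_limit)
      fix n
      have "snd (approx r n) i \<in> carrier W" using approx_in[OF r, of n] i by blast
      then show "\<exists>h\<in>carrier W. agree n (b i) h" using bb by blast
    qed
  qed (auto simp: b_def)
  note st = step_agree[OF r aW bW approx_in[OF r, THEN conjunct1] approx_in[OF r, THEN conjunct2]
      aa bb]
  have "agree n (a i) (step_a r a b i)" for n i
    using aa[of "Suc n" i] st(1)[of n i] by (simp add: agree_def)
  then have "a = step_a r a b" by (meson agree_all ext)
  moreover have "agree n (b i) (step_b r b i)" for n i
    using bb[of "Suc n" i] st(2)[of n i] by (simp add: agree_def)
  then have "b = step_b r b" by (meson agree_all ext)
  ultimately show ?thesis using recursion_relations_iff[OF r] aW bW by blast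
qed

lemma recursion_relations_ex1:
  assumes "r \<ge> 1"
  shows "\<exists>!p. recursion_relations r (fst p) (snd p)"
  using recursion_relations_exists[OF assms] recursion_relations_unique[OF assms]
  by (metis fst_conv prod_eqI snd_conv)

lemma recursion_relations_gens:
  assumes "r \<ge> 1"
  shows "recursion_relations r (gen_a r) (gen_b r)"
  using theI'[OF recursion_relations_ex1[OF assms]] by (simp add: gen_a_def gen_b_def gens_def)

lemma W_proj_eq_iff: "W_proj n g = W_proj n h \<longleftrightarrow> agree n g h"
  by (auto simp: W_proj_def trunc_tree_def agree_def fun_eq_iff restrict_def)

lemma W_proj_in:
  assumes "g \<in> carrier W" shows "W_proj n g \<in> tree_aut (trunc_tree n)"
proof -
  have g: "bij g" "g [] = []" "\<And>s t. tree_adj (g s) (g t) \<longleftrightarrow> tree_adj s t"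
    using assms by (auto simp: carrier_W_iff)
  have "t \<in> g ` trunc_tree n" if "t \<in> trunc_tree n" for t
  proof
    show "t = g (inv_into UNIV g t)" using g(1) by (simp add: bij_is_surj surj_f_inv_f)
    show "inv_into UNIV g t \<in> trunc_tree n"
      using that length_W[OF inv_in_W[OF assms]] by (simp add: trunc_tree_def)
  qed
  then have "g ` trunc_tree n = trunc_tree n"
    using length_W[OF assms] by (auto simp: trunc_tree_def)
  then have "bij_betw g (trunc_tree n) (trunc_tree n)"
    using g(1) by (auto simp: bij_betw_def intro: inj_on_subset)
  moreover have "bij_betw (W_proj n g) (trunc_tree n) (trunc_tree n) \<longleftrightarrow>
      bij_betw g (trunc_tree n) (trunc_tree n)"
    by (rule bij_betw_cong) (simp add: W_proj_def)
  ultimately show ?thesis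
    using g by (auto simp: tree_aut_def W_proj_def trunc_tree_def)
qed

lemma openin_W_ball:
  assumes "openin W_topology U" "g \<in> U"
  shows "\<exists>n. \<forall>h\<in>carrier W. agree n g h \<longrightarrow> h \<in> U"
proof -
  have "generate_topology_on
      {{g \<in> carrier W. W_proj n g \<in> U} | n U. U \<subseteq> tree_aut (trunc_tree n)} U"
    using assms(1) by (simp add: W_topology_def openin_topology_generated_by_iff)
  then show ?thesis using assms(2)
  proof (induction arbitrary: g)
    case (Int A B)
    then obtain m n where "\<forall>h\<in>carrier W. agree m g h \<longrightarrow> h \<in> A" "\<forall>h\<in>carrier W. agree n g h \<longrightarrow> h \<in> B"
      by blast
    then have "\<forall>h\<in>carrier W. agree (max m n) g h \<longrightarrow> h \<in> A \<inter> B"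
      by (auto simp: agree_def)
    then show ?case by blast
  next
    case (UN K)
    then obtain A where "A \<in> K" "g \<in> A" by blast
    then show ?case using UN.IH[of A g] by blast
  next
    case (Basis A)
    then obtain n V where A: "A = {g \<in> carrier W. W_proj n g \<in> V}" by blast
    then have "\<forall>h\<in>carrier W. agree n g h \<longrightarrow> h \<in> A"
      using Basis.prems by (auto simp flip: W_proj_eq_iff)
    then show ?case by blast
  qed auto
qed

lemma openin_W_basis:
  assumes "g \<in> carrier W" shows "openin W_topology {h \<in> carrier W. agree n g h}"
proof -
  have "{h \<in> carrier W. W_proj n h \<in> {W_proj n g}} = {h \<in> carrier W. agree n g h}"
    by (auto simp flip: W_proj_eq_iff)
  moreover have "{W_proj n g} \<subseteq> tree_aut (trunc_tree n)" using W_proj_in[OF assms] by simp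
  ultimately show ?thesis
    unfolding W_topology_def by (intro topology_generated_by_Basis) blast
qed

lemma topspace_W_topology: "topspace W_topology = carrier W"
proof
  show "topspace W_topology \<subseteq> carrier W"
    unfolding W_topology_def topology_generated_by_topspace by blast
  show "carrier W \<subseteq> topspace W_topology"
    using openin_W_basis openin_subset by fastforce
qed

lemma W_closure_iff:
  "g \<in> Abstract_Topology.closure_of W_topology X \<longleftrightarrow> g \<in> carrier W \<and> (\<forall>n. \<exists>h\<in>X \<inter> carrier W. agree n g h)"
proof
  assume g: "g \<in> Abstract_Topology.closure_of W_topology X"
  then have gW: "g \<in> carrier W" by (simp add: in_closure_of topspace_W_topology)
  moreover have "\<exists>h\<in>X \<inter> carrier W. agree n g h" for n
    using g gW openin_W_basis[OF gW, of n] unfolding in_closure_of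
    by (metis (mono_tags, lifting) IntI agree_refl mem_Collect_eq)
  ultimately show "g \<in> carrier W \<and> (\<forall>n. \<exists>h\<in>X \<inter> carrier W. agree n g h)" by blast
next
  assume R: "g \<in> carrier W \<and> (\<forall>n. \<exists>h\<in>X \<inter> carrier W. agree n g h)"
  have "\<exists>y\<in>X. y \<in> U" if "g \<in> U" "openin W_topology U" for U
    using openin_W_ball[OF that(2,1)] R by blast
  then show "g \<in> Abstract_Topology.closure_of W_topology X"
    using R by (auto simp: in_closure_of topspace_W_topology)
qed

lemma G_closed_subgroup:
  assumes "r \<ge> 1"
  shows "closedin W_topology (G r)" "subgroup (G r) W"
proof -
  show "closedin W_topology (G r)" by (simp add: G_def)
  define H where "H = generate W (gen_a r ` {1..} \<union> gen_b r ` {1..r})"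
  have "gen_a r ` {1..} \<union> gen_b r ` {1..r} \<subseteq> carrier W"
    using recursion_relations_gens[OF assms] unfolding recursion_relations_def by auto
  then have H: "subgroup H W" unfolding H_def by (rule group.generate_is_subgroup[OF group_W])
  have HW: "H \<subseteq> carrier W" by (rule subgroup.subset[OF H])
  have mem: "g \<in> G r \<longleftrightarrow> g \<in> carrier W \<and> (\<forall>n. \<exists>h\<in>H. agree n g h)" for g
    unfolding G_def W_closure_iff H_def[symmetric] using HW by blast
  show "subgroup (G r) W"
  proof (rule group.subgroupI[OF group_W])
    show "G r \<subseteq> carrier W" using mem by blast
    have "id \<in> H" using subgroup.one_closed[OF H] by simp
    then have "id \<in> G r" unfolding mem using id_in_W agree_refl by blast
    then show "G r \<noteq> {}" by blast
  next
    fix g assume g: "g \<in> G r"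
    have "\<exists>h\<in>H. agree n (inv\<^bsub>W\<^esub> g) h" for n
    proof -
      obtain h where "h \<in> H" "agree n g h" using g mem by blast
      then show ?thesis
        using g mem HW agree_inv[of n g h] subgroup.m_inv_closed[OF H, of h] by blast
    qed
    then show "inv\<^bsub>W\<^esub> g \<in> G r"
      using g mem group.inv_closed[OF group_W] by blast
  next
    fix g k assume gk: "g \<in> G r" "k \<in> G r"
    have "\<exists>h\<in>H. agree n (g \<otimes>\<^bsub>W\<^esub> k) h" for n
    proof -
      obtain g' k' where "g' \<in> H" "k' \<in> H" "agree n g g'" "agree n k k'"
        using gk mem by blast
      then show ?thesis
        using agree_comp[of n g g' k k'] gk mem subgroup.m_closed[OF H, of g' k']
        unfolding mult_W by blast
    qed
    then show "g \<otimes>\<^bsub>W\<^esub> k \<in> G r"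
      using gk mem comp_in_W by simp
  qed
qed

end

theory Submission
  imports Defs
begin

text \<open>All generators are involutions. Let \<open>H\<close> be the abstract group that they generate and
  let $\chi$ be the parity of the number of switches on level $r - 1$. Every generator has an even
  number of switches on level $r$, so if $(u,v)$ or $(u,v)\sigma$ lies in \<open>H\<close>, then
  $u, v \in H$ and $\chi(u) = \chi(v)$. Conversely every such $(u,v)$ lies in \<open>H\<close>: each $u \in H$ has
  $(u,1) \in H$ or $(u,b_r) \in H$, since this holds for the generators. As $\chi$ is visible on
  \<open>T\<^sub>n\<close> exactly if $n \geq r$, the order of \<open>H\<^sub>n\<^sub>+\<^sub>1\<close> is $2\,|H_n|^2$ for $n < r$ and $|H_n|^2$ for
  $n \geq r$; hence $\log_2 |H_n| = 2^n - 2^{n-r}$ for $n \geq r$.\<close>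

section \<open>Pairs, the swap and switch parities\<close>

lemma tpair_comp: "tpair u v \<circ> tpair u' v' = tpair (u \<circ> u') (v \<circ> v')"
proof
  show "(tpair u v \<circ> tpair u' v') t = tpair (u \<circ> u') (v \<circ> v') t" for t by (cases t) auto
qed

lemma swap_tpair: "tree_swap \<circ> tpair u v = tpair v u \<circ> tree_swap"
proof
  show "(tree_swap \<circ> tpair u v) t = (tpair v u \<circ> tree_swap) t" for t by (cases t) auto
qed

lemma tree_swap_tree_swap: "tree_swap \<circ> tree_swap = id"
proof
  show "(tree_swap \<circ> tree_swap) t = id t" for t by (cases t) auto
qed

lemma tpair_id: "tpair id id = id"
proof
  show "tpair id id t = id t" for t by (cases t) auto
qed

lemma comp_swap_cancel: "g \<circ> tree_swap \<circ> tree_swap = g"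
  by (simp add: comp_assoc tree_swap_tree_swap)

lemma swap_tpair_swap: "tree_swap \<circ> tpair u v \<circ> tree_swap = tpair v u"
  by (simp add: swap_tpair comp_swap_cancel)

lemma tpair_swap_mult:
  "tpair u v \<circ> (tpair u' v' \<circ> tree_swap) = tpair (u \<circ> u') (v \<circ> v') \<circ> tree_swap"
  "tpair u v \<circ> tree_swap \<circ> tpair u' v' = tpair (u \<circ> v') (v \<circ> u') \<circ> tree_swap"
  "tpair u v \<circ> tree_swap \<circ> (tpair u' v' \<circ> tree_swap) = tpair (u \<circ> v') (v \<circ> u')"
proof -
  show "tpair u v \<circ> (tpair u' v' \<circ> tree_swap) = tpair (u \<circ> u') (v \<circ> v') \<circ> tree_swap"
    by (simp only: comp_assoc[symmetric] tpair_comp)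
  show *: "tpair u v \<circ> tree_swap \<circ> tpair u' v' = tpair (u \<circ> v') (v \<circ> u') \<circ> tree_swap"
    by (simp only: comp_assoc swap_tpair) (simp only: comp_assoc[symmetric] tpair_comp)
  show "tpair u v \<circ> tree_swap \<circ> (tpair u' v' \<circ> tree_swap) = tpair (u \<circ> v') (v \<circ> u')"
    by (simp only: comp_assoc[symmetric] * comp_swap_cancel)
qed

lemma inv_involution:
  assumes "g \<in> carrier W" "g \<circ> g = id" shows "inv\<^bsub>W\<^esub> g = g"
  using group.inv_equality[OF group_W, of g g] assms by simp

text \<open>\<open>level_parity m g\<close>: the number of vertices of level $m$ at which \<open>g\<close> switches the two children
  is odd.\<close>

primrec level_parity :: "nat \<Rightarrow> (word \<Rightarrow> word) \<Rightarrow> bool" where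
  "level_parity 0 g = (hd (g [False]))"
| "level_parity (Suc m) g =
    (level_parity m (\<lambda>t. tl (g (False # t))) \<noteq> level_parity m (\<lambda>t. tl (g (True # t))))"

text \<open>Right multiplication by \<open>tree_swap\<close> exchanges the two sections. Their
  parities enter symmetrically, so the swap is visible at the root only.\<close>

lemma level_parity_tpair [simp]:
  "level_parity 0 (tpair u v) = False"
  "level_parity 0 (tpair u v \<circ> tree_swap) = True"
  "level_parity (Suc m) (tpair u v) = (level_parity m u \<noteq> level_parity m v)"
  "level_parity (Suc m) (tpair u v \<circ> tree_swap) = (level_parity m u \<noteq> level_parity m v)"
  by auto

lemma level_parity_id [simp]: "level_parity m id = False"
  using level_parity_tpair(1,3)[where u = id and v = id] unfolding tpair_id by (cases m) auto

lemma level_parity_swap: "level_parity m tree_swap \<longleftrightarrow> m = 0"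
proof -
  have "tree_swap = tpair id id \<circ> tree_swap" by (simp add: tpair_id)
  then show ?thesis using level_parity_tpair(2,4)[where u = id and v = id] by (cases m) auto
qed

text \<open>A switch at level \<open>m\<close> shows in the images of vertices of level
  \<open>Suc m\<close>. For \<open>m = r - 1\<close> this puts the threshold at truncation level
  \<open>r\<close>.\<close>

lemma level_parity_agree: "agree (Suc m) g h \<Longrightarrow> level_parity m g = level_parity m h"
proof (induction m arbitrary: g h)
  case (Suc m)
  have "agree (Suc m) (\<lambda>t. tl (g (x # t))) (\<lambda>t. tl (h (x # t)))" for x
    using Suc.prems by (simp add: agree_def)
  from Suc.IH[OF this] show ?case by simp
qed (simp add: agree_def)

section \<open>Truncations, and the passage from the closure to the abstract group\<close>

lemma agree_tpair_iff: "agree (Suc n) (tpair u v) (tpair u' v') \<longleftrightarrow> agree n u u' \<and> agree n v v'"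
proof
  assume L: "agree (Suc n) (tpair u v) (tpair u' v')"
  show "agree n u u' \<and> agree n v v'"
    unfolding agree_def
  proof (intro conjI allI impI)
    fix t :: word assume "length t \<le> n"
    then show "u t = u' t" "v t = v' t"
      using L[unfolded agree_def, rule_format, of "False # t"]
        L[unfolded agree_def, rule_format, of "True # t"] by simp_all
  qed
qed (simp add: agree_tpair)

lemma agree_swap_iff: "agree n (g \<circ> tree_swap) (h \<circ> tree_swap) \<longleftrightarrow> agree n g h"
  using agree_comp[of n "g \<circ> tree_swap" "h \<circ> tree_swap" tree_swap tree_swap]
    agree_comp[of n g h tree_swap tree_swap]
  by (auto simp: comp_swap_cancel)

lemma not_agree_tpair_swap: "\<not> agree (Suc n) (tpair u v) (tpair u' v' \<circ> tree_swap)"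
proof
  assume "agree (Suc n) (tpair u v) (tpair u' v' \<circ> tree_swap)"
  then have "tpair u v [False] = (tpair u' v' \<circ> tree_swap) [False]"
    unfolding agree_def by (auto dest: spec[of _ "[False]"])
  then show False by simp
qed

lemma finite_W_proj:
  assumes "X \<subseteq> carrier W" shows "finite (W_proj n ` X)"
proof -
  have "trunc_tree n = {t. set t \<subseteq> UNIV \<and> length t \<le> n}" by (simp add: trunc_tree_def)
  then have "finite (trunc_tree n)" using finite_lists_length_le[of "UNIV :: bool set" n] by simp
  moreover have "W_proj n ` X \<subseteq> trunc_tree n \<rightarrow>\<^sub>E trunc_tree n"
    using assms length_W by (auto simp: W_proj_def trunc_tree_def split: if_splits)
  ultimately show ?thesis by (meson finite_PiE finite_subset)
qed

lemma square_two_power: "((2::nat) ^ 2 ^ k)\<^sup>2 = 2 ^ 2 ^ Suc k"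
  by (simp only: power2_eq_square power_add[symmetric] power_Suc mult_2)

definition gen_group :: "nat \<Rightarrow> (word \<Rightarrow> word) set" where
  "gen_group r = generate W (gen_a r ` {1..} \<union> gen_b r ` {1..r})"

text \<open>Each element of the closure agrees with some element of \<open>gen_group r\<close> down
  to level \<open>n\<close>. So the orders can be computed in the abstract group.\<close>

lemma W_proj_G:
  assumes "gen_group r \<subseteq> carrier W" shows "W_proj n ` G r = W_proj n ` gen_group r"
proof
  have G: "G r = Abstract_Topology.closure_of W_topology (gen_group r)"
    by (simp add: G_def gen_group_def)
  show "W_proj n ` G r \<subseteq> W_proj n ` gen_group r"
  proof
    fix p assume "p \<in> W_proj n ` G r"
    then obtain g where g: "g \<in> G r" "p = W_proj n g" by blast
    then obtain h where "h \<in> gen_group r" "agree n g h" unfolding G W_closure_iff by blast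
    then show "p \<in> W_proj n ` gen_group r" using g(2) by (simp add: W_proj_eq_iff image_iff) blast
  qed
  have "gen_group r \<subseteq> G r"
    unfolding G using assms by (intro closure_of_subset) (simp add: topspace_W_topology)
  then show "W_proj n ` gen_group r \<subseteq> W_proj n ` G r" by blast
qed

context
  fixes r :: nat
  assumes r: "r \<ge> 1"
begin

private abbreviation "a \<equiv> gen_a r"
private abbreviation "b \<equiv> gen_b r"
private abbreviation "H \<equiv> gen_group r"
private abbreviation "chi \<equiv> level_parity (r - 1)"

section \<open>The generators are involutions\<close>

lemma a_in_W: "i \<ge> 1 \<Longrightarrow> a i \<in> carrier W"
  and b_in_W: "j \<in> {1..r} \<Longrightarrow> b j \<in> carrier W"
proof -
  have "a \<in> {1..} \<rightarrow>\<^sub>E carrier W" "b \<in> {1..r} \<rightarrow>\<^sub>E carrier W"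
    using recursion_relations_gens[OF r] unfolding recursion_relations_def by blast+
  then show "i \<ge> 1 \<Longrightarrow> a i \<in> carrier W" "j \<in> {1..r} \<Longrightarrow> b j \<in> carrier W" by (auto dest: PiE_mem)
qed

lemma b_br_in_W: "b r \<in> carrier W"
  using b_in_W r by simp

lemma a_rec:
  "a 1 = tree_swap"
  "a (Suc r) = tpair (a r) (b r)"
  "i \<ge> 1 \<Longrightarrow> i \<noteq> r \<Longrightarrow> a (Suc i) = tpair (a i) id"
proof -
  have R: "a 1 = tree_swap" "a (r + 1) = tpair (a r) (b r)"
     "\<forall>i>1. i \<noteq> r + 1 \<longrightarrow> a i = tpair (a (i - 1)) \<one>\<^bsub>W\<^esub>"
    using recursion_relations_gens[OF r] unfolding recursion_relations_def by blast+
  show "a 1 = tree_swap" "a (Suc r) = tpair (a r) (b r)" using R(1,2) by simp_all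
  show "a (Suc i) = tpair (a i) id" if "i \<ge> 1" "i \<noteq> r" using R(3)[rule_format, of "Suc i"] that by simp
qed

lemma b_rec_inv:
  "b 1 = tpair (b r) (inv\<^bsub>W\<^esub> (b r)) \<circ> tree_swap"
  "j \<ge> 1 \<Longrightarrow> j < r \<Longrightarrow> b (Suc j) = tpair (b r \<circ> b j \<circ> inv\<^bsub>W\<^esub> (b r)) id"
proof -
  have R: "b 1 = tpair (b r) (inv\<^bsub>W\<^esub> (b r)) \<otimes>\<^bsub>W\<^esub> tree_swap"
     "\<forall>j. 1 < j \<and> j \<le> r \<longrightarrow>
        b j = tpair (b r \<otimes>\<^bsub>W\<^esub> b (j - 1) \<otimes>\<^bsub>W\<^esub> inv\<^bsub>W\<^esub> (b r)) \<one>\<^bsub>W\<^esub>"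
    using recursion_relations_gens[OF r] unfolding recursion_relations_def by blast+
  show "b 1 = tpair (b r) (inv\<^bsub>W\<^esub> (b r)) \<circ> tree_swap" using R(1) by simp
  show "b (Suc j) = tpair (b r \<circ> b j \<circ> inv\<^bsub>W\<^esub> (b r)) id" if "j \<ge> 1" "j < r"
    using R(2)[rule_format, of "Suc j"] that by simp
qed

text \<open>In the square of \<open>b 1\<close> the swap exchanges the two entries, so each entry
  becomes a product of \<open>b r\<close> and its inverse. The entry of \<open>b (Suc j)\<close> is
  a conjugate of \<open>b j\<close>. That \<open>b r\<close> is itself an involution is only the
  last case, so there is no circularity.\<close>

lemma b_involution:
  assumes "j \<in> {1..r}" shows "b j \<circ> b j = id"
proof -
  have "j \<ge> 1" "j \<le> r" using assms by auto
  have c: "b r \<circ> inv\<^bsub>W\<^esub> (b r) = id" "inv\<^bsub>W\<^esub> (b r) \<circ> b r = id"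
    using group.r_inv[OF group_W b_br_in_W] group.l_inv[OF group_W b_br_in_W] by simp_all
  show ?thesis using \<open>j \<ge> 1\<close> \<open>j \<le> r\<close>
  proof (induction j rule: dec_induct)
    case base
    have "b 1 \<circ> b 1 = tpair (b r) (inv\<^bsub>W\<^esub> (b r)) \<circ> (tree_swap \<circ> tpair (b r) (inv\<^bsub>W\<^esub> (b r)) \<circ> tree_swap)"
      by (simp only: b_rec_inv(1) comp_assoc)
    also have "\<dots> = id" by (simp only: swap_tpair_swap tpair_comp c tpair_id)
    finally show ?case .
  next
    case (step j)
    have bj: "b j \<circ> b j = id" by (rule step.IH) (use step.prems in simp)
    have "(b r \<circ> b j \<circ> inv\<^bsub>W\<^esub> (b r)) \<circ> (b r \<circ> b j \<circ> inv\<^bsub>W\<^esub> (b r))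
        = b r \<circ> b j \<circ> (inv\<^bsub>W\<^esub> (b r) \<circ> b r) \<circ> b j \<circ> inv\<^bsub>W\<^esub> (b r)"
      by (simp only: comp_assoc)
    also have "\<dots> = b r \<circ> (b j \<circ> b j) \<circ> inv\<^bsub>W\<^esub> (b r)" by (simp only: c comp_id comp_assoc)
    also have "\<dots> = id" using bj by (simp add: c)
    finally have *: "(b r \<circ> b j \<circ> inv\<^bsub>W\<^esub> (b r)) \<circ> (b r \<circ> b j \<circ> inv\<^bsub>W\<^esub> (b r)) = id" .
    have "b (Suc j) = tpair (b r \<circ> b j \<circ> inv\<^bsub>W\<^esub> (b r)) id"
      using step by (simp add: b_rec_inv(2))
    then show "b (Suc j) \<circ> b (Suc j) = id" by (simp only: * tpair_comp comp_id tpair_id)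
  qed
qed

lemma br_involution: "b r \<circ> b r = id"
  using b_involution r by simp

lemma b_rec:
  "b 1 = tpair (b r) (b r) \<circ> tree_swap"
  "j \<ge> 1 \<Longrightarrow> j < r \<Longrightarrow> b (Suc j) = tpair (b r \<circ> b j \<circ> b r) id"
  using b_rec_inv inv_involution[OF b_br_in_W br_involution] by simp_all

lemma a_involution:
  assumes "i \<ge> 1" shows "a i \<circ> a i = id"
  using assms
proof (induction i rule: dec_induct)
  case base
  show ?case using a_rec(1) tree_swap_tree_swap by simp
next
  case (step i)
  have "a i \<circ> a i = id" by (rule step.IH)
  then show "a (Suc i) \<circ> a (Suc i) = id"
    using step(1) by (cases "i = r") (simp_all add: a_rec tpair_comp br_involution tpair_id)
qed

section \<open>The abstract group and its sections\<close>

lemma gen_group_a [simp]: "i \<ge> 1 \<Longrightarrow> a i \<in> H"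
  and gen_group_b: "j \<in> {1..r} \<Longrightarrow> b j \<in> H"
  unfolding gen_group_def by (auto intro: generate.incl)

lemma gen_group_br [simp]: "b r \<in> H"
  using gen_group_b r by simp

lemma gen_group_id [simp]: "id \<in> H"
  using generate.one[of W] unfolding gen_group_def one_W .

lemma gen_group_comp [simp]: "g \<in> H \<Longrightarrow> h \<in> H \<Longrightarrow> g \<circ> h \<in> H"
  using generate.eng[of g W _ h] unfolding gen_group_def mult_W .

lemma gen_group_swap [simp]: "tree_swap \<in> H"
  using gen_group_a[of 1] unfolding a_rec(1) by simp

text \<open>The element is \<open>b 1\<close> times the swap. It serves to undo the conjugations by
  \<open>b r\<close> and to correct second entries.\<close>

lemma tpair_br_br: "tpair (b r) (b r) \<in> H"
  using gen_group_comp[OF gen_group_b[of 1] gen_group_swap] r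
  unfolding b_rec(1) comp_swap_cancel by simp

text \<open>In \<open>generate\<close> only generators get inverted, and these are involutions;
  hence no case for inverses remains.\<close>

lemma gen_group_induct [consumes 1, case_names id a b comp]:
  assumes "g \<in> H" and id: "P id" and a: "\<And>i. i \<ge> 1 \<Longrightarrow> P (a i)"
    and b: "\<And>j. j \<in> {1..r} \<Longrightarrow> P (b j)"
    and comp: "\<And>g h. g \<in> H \<Longrightarrow> h \<in> H \<Longrightarrow> P g \<Longrightarrow> P h \<Longrightarrow> P (g \<circ> h)"
  shows "P g"
  using assms(1) unfolding gen_group_def
proof (induction g rule: generate.induct)
  case (inv h)
  then have "h \<in> carrier W \<and> h \<circ> h = id"
    using a_in_W b_in_W a_involution b_involution by auto
  then have "inv\<^bsub>W\<^esub> h = h" using inv_involution by blast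
  then show "P (inv\<^bsub>W\<^esub> h)" using inv a b by auto
next
  case one
  show "P \<one>\<^bsub>W\<^esub>" using id by (simp only: one_W)
next
  case (eng g h)
  then have "P (g \<circ> h)" by (intro comp) (simp_all only: gen_group_def)
  then show "P (g \<otimes>\<^bsub>W\<^esub> h)" by (simp only: mult_W)
next
  case (incl h)
  then consider i where "i \<ge> 1" "h = local.a i" | j where "j \<in> {1..r}" "h = local.b j" by auto
  then show "P h" using a b by cases simp_all
qed

lemma gen_group_in_W: "g \<in> H \<Longrightarrow> g \<in> carrier W"
proof (induction g rule: gen_group_induct)
  case (comp g h)
  then show "g \<circ> h \<in> carrier W" by (simp add: comp_in_W)
qed (use a_in_W b_in_W in \<open>simp_all only: id_in_W\<close>)

text \<open>Self-similarity: the recursions exhibit sections of the generators in \<open>H\<close>,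
  and the sections of a product are products of sections.\<close>

lemma gen_group_cases:
  assumes "g \<in> H"
  obtains u v where "u \<in> H" "v \<in> H" "g = tpair u v"
  | u v where "u \<in> H" "v \<in> H" "g = tpair u v \<circ> tree_swap"
proof -
  have "\<exists>u\<in>H. \<exists>v\<in>H. g = tpair u v \<or> g = tpair u v \<circ> tree_swap"
    using assms
  proof (induction g rule: gen_group_induct)
    case id
    show ?case using tpair_id gen_group_id by metis
  next
    case (a i)
    show ?case
    proof (cases "i = 1")
      case True
      then have "a i = tpair id id \<circ> tree_swap" by (simp add: a_rec(1) tpair_id del: One_nat_def)
      then show ?thesis using gen_group_id by blast
    next
      case False
      then obtain k where k: "i = Suc k" "k \<ge> 1" using a by (cases i) auto
      then have "a i = tpair (a k) (b r) \<or> a i = tpair (a k) id" using a_rec(2,3) by blast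
      then show ?thesis using k gen_group_a gen_group_br gen_group_id by blast
    qed
  next
    case (b j)
    show ?case
    proof (cases "j = 1")
      case True
      then show ?thesis using b_rec(1) gen_group_br by blast
    next
      case False
      then obtain k where k: "j = Suc k" "k \<ge> 1" using b by (cases j) auto
      then have "b j = tpair (b r \<circ> b k \<circ> b r) id" "b k \<in> H"
        using b_rec(2) b gen_group_b by auto
      then show ?thesis using gen_group_br gen_group_id gen_group_comp by blast
    qed
  next
    case (comp g h)
    then obtain u v u' v' where uv: "u \<in> H" "v \<in> H" "u' \<in> H" "v' \<in> H"
      and gh: "g = tpair u v \<or> g = tpair u v \<circ> tree_swap"
        "h = tpair u' v' \<or> h = tpair u' v' \<circ> tree_swap" by blast
    have "g \<circ> h \<in> {tpair (u \<circ> u') (v \<circ> v'), tpair (u \<circ> v') (v \<circ> u'),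
        tpair (u \<circ> u') (v \<circ> v') \<circ> tree_swap, tpair (u \<circ> v') (v \<circ> u') \<circ> tree_swap}"
      using gh by (elim disjE) (simp_all add: tpair_comp tpair_swap_mult)
    then show ?case using uv gen_group_comp by blast
  qed
  then show ?thesis using that by blast
qed

section \<open>Switch parities on the group\<close>

text \<open>An automorphism permutes each level, so the numbers of switches add modulo 2. Formally
  the sections from \<open>gen_group_cases\<close> carry an induction on the level.\<close>

lemma level_parity_comp:
  assumes "g \<in> H" "h \<in> H"
  shows "level_parity m (g \<circ> h) \<longleftrightarrow> level_parity m g \<noteq> level_parity m h"
  using assms
proof (induction m arbitrary: g h)
  case 0
  show "level_parity 0 (g \<circ> h) \<longleftrightarrow> level_parity 0 g \<noteq> level_parity 0 h"
    by (rule gen_group_cases[OF 0(1)]; rule gen_group_cases[OF 0(2)])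
      (simp_all add: tpair_comp tpair_swap_mult del: level_parity.simps)
next
  case (Suc m)
  have IH: "level_parity m (u \<circ> v) \<longleftrightarrow> level_parity m u \<noteq> level_parity m v"
    if "u \<in> H" "v \<in> H" for u v by (rule Suc.IH) (rule that)+
  show "level_parity (Suc m) (g \<circ> h) \<longleftrightarrow> level_parity (Suc m) g \<noteq> level_parity (Suc m) h"
    by (rule gen_group_cases[OF Suc.prems(1)]; rule gen_group_cases[OF Suc.prems(2)])
      (simp_all add: tpair_comp tpair_swap_mult IH del: level_parity.simps, auto)
qed

text \<open>Below the root of \<open>b 1\<close> the two equal sections cancel. Conjugation by
  \<open>b r\<close> leaves parities unchanged, so each further index moves the single odd level
  down by one.\<close>

lemma level_parity_b:
  assumes "j \<in> {1..r}" shows "level_parity m (b j) \<longleftrightarrow> m = j - 1"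
proof -
  have "j \<ge> 1" "j \<le> r" using assms by auto
  then show ?thesis
  proof (induction j arbitrary: m rule: dec_induct)
    case base
    show "level_parity m (b 1) \<longleftrightarrow> m = 1 - 1"
      unfolding b_rec(1) by (cases m) (simp_all del: level_parity.simps)
  next
    case (step j)
    have IH: "level_parity k (b j) \<longleftrightarrow> k = j - 1" for k
      by (rule step.IH) (use step.prems in simp)
    have "b j \<in> H" using step.hyps step.prems by (intro gen_group_b) simp
    then have conj: "level_parity k (b r \<circ> b j \<circ> b r) \<longleftrightarrow> level_parity k (b j)" for k
      using level_parity_comp[of "b r \<circ> b j" "b r" k] level_parity_comp[of "b r" "b j" k] by auto
    have rec: "b (Suc j) = tpair (b r \<circ> b j \<circ> b r) id"
      using step.hyps step.prems by (intro b_rec(2)) simp_all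
    show "level_parity m (b (Suc j)) \<longleftrightarrow> m = Suc j - 1"
    proof (cases m)
      case 0
      then show ?thesis using step.hyps by (simp only: rec level_parity_tpair) simp
    next
      case (Suc k)
      then show ?thesis
        using step.hyps by (simp only: rec level_parity_tpair level_parity_id conj IH) auto
    qed
  qed
qed

text \<open>The odd level moves down by one per index until \<open>a (Suc r)\<close>. There the
  sections \<open>a r\<close> and \<open>b r\<close> are both odd exactly on level
  \<open>r - 1\<close> and cancel; all later generators inherit even parities.\<close>

lemma level_parity_a:
  assumes "i \<ge> 1" shows "level_parity m (a i) \<longleftrightarrow> i \<le> r \<and> m = i - 1"
  using assms
proof (induction i arbitrary: m rule: dec_induct)
  case base
  show ?case using a_rec(1) level_parity_swap r by simp
next
  case (step i)
  show ?case
  proof (cases "i = r")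
    case True
    then show ?thesis
      using r step.IH level_parity_b[of r]
      by (cases m) (auto simp: a_rec(2) simp del: level_parity.simps)
  next
    case False
    then show ?thesis
      using step by (cases m) (auto simp: a_rec(3) simp del: level_parity.simps)
  qed
qed

text \<open>This is the source of the constraint on sections: on level \<open>r\<close> the parity
  of a pair is the sum of the \<open>chi\<close> of its entries.\<close>

lemma level_parity_r: "g \<in> H \<Longrightarrow> \<not> level_parity r g"
proof (induction g rule: gen_group_induct)
  case id
  show "\<not> level_parity r id" by simp
next
  case (a i)
  then show ?case using level_parity_a[of i r] r by auto
next
  case (b j)
  then show ?case using level_parity_b[of j r] by auto
next
  case (comp g h)
  then show "\<not> level_parity r (g \<circ> h)" by (simp add: level_parity_comp)
qed

section \<open>Which pairs lie in the group\<close>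

text \<open>A pair determines its entries and never swaps the subtrees, so the sections supplied by
  \<open>gen_group_cases\<close> are \<open>u\<close> and \<open>v\<close> themselves.\<close>

lemma tpair_in_gen_group_imp:
  assumes "tpair u v \<in> H" shows "u \<in> H" "v \<in> H" "chi u = chi v"
proof -
  have "u \<in> H \<and> v \<in> H"
    using assms
  proof (cases rule: gen_group_cases)
    case (1 u' v')
    then have "agree (Suc n) (tpair u v) (tpair u' v')" for n by simp
    then have *: "agree n u u' \<and> agree n v v'" for n unfolding agree_tpair_iff .
    have "u = u'" by (rule agree_all) (rule *[THEN conjunct1])
    moreover have "v = v'" by (rule agree_all) (rule *[THEN conjunct2])
    ultimately show ?thesis using 1 by simp
  next
    case (2 u' v')
    then have "agree (Suc 0) (tpair u v) (tpair u' v' \<circ> tree_swap)" by simp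
    then show ?thesis using not_agree_tpair_swap by blast
  qed
  then show "u \<in> H" "v \<in> H" by simp_all
  show "chi u = chi v"
    using level_parity_r[OF assms] level_parity_tpair(3)[of "r - 1" u v] r by simp
qed

text \<open>For \<open>a i\<close> and for \<open>b j\<close> with \<open>j < r\<close> the pair
  comes from the generator with the next index; for \<open>b r\<close> it is
  \<open>tpair_br_br\<close>. Products stay within the claim because \<open>id\<close> and
  \<open>b r\<close> form a group.\<close>

lemma section_pairs:
  assumes "u \<in> H" shows "tpair u id \<in> H \<or> tpair u (b r) \<in> H"
  using assms
proof (induction u rule: gen_group_induct)
  case id
  show "tpair id id \<in> H \<or> tpair id (b r) \<in> H" by (simp add: tpair_id)
next
  case (a i)
  have "a (Suc i) \<in> H" by simp
  moreover have "a (Suc i) = tpair (a i) (b r) \<or> a (Suc i) = tpair (a i) id"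
    using a_rec(2,3) a by blast
  ultimately show "tpair (a i) id \<in> H \<or> tpair (a i) (b r) \<in> H" by metis
next
  case (b j)
  show "tpair (b j) id \<in> H \<or> tpair (b j) (b r) \<in> H"
  proof (cases "j = r")
    case False
    then have "tpair (b r \<circ> b j \<circ> b r) id \<in> H"
      using b gen_group_b[of "Suc j"] b_rec(2)[of j] by auto
    \<comment> \<open>Conjugating by this pair strips \<open>b r\<close> from both sides of the
      first entry and turns the second into \<open>b r \<circ> b r = id\<close>.\<close>
    then have "tpair (b r) (b r) \<circ> tpair (b r \<circ> b j \<circ> b r) id \<circ> tpair (b r) (b r) \<in> H"
      using tpair_br_br gen_group_comp by blast
    moreover have "b r \<circ> (b r \<circ> b j \<circ> b r) \<circ> b r = (b r \<circ> b r) \<circ> b j \<circ> (b r \<circ> b r)"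
      by (simp only: comp_assoc)
    ultimately show ?thesis by (simp add: tpair_comp br_involution)
  qed (use tpair_br_br in simp)
next
  case (comp g h)
  then obtain x y where xy: "tpair g x \<in> H" "tpair h y \<in> H" "x \<in> {id, b r}" "y \<in> {id, b r}"
    by blast
  then have "tpair (g \<circ> h) (x \<circ> y) \<in> H" using gen_group_comp tpair_comp by metis
  moreover have "x \<circ> y \<in> {id, b r}" using xy(3,4) br_involution by auto
  ultimately show "tpair (g \<circ> h) id \<in> H \<or> tpair (g \<circ> h) (b r) \<in> H" by auto
qed

text \<open>Complete \<open>u\<close> and \<open>v\<close> to pairs with second entries
  \<open>x\<close> and \<open>y\<close> in \<open>{id, b r}\<close>. Since \<open>chi\<close>
  separates \<open>id\<close> from \<open>b r\<close> and is equal on the entries of a pair in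
  \<open>H\<close>, the hypothesis forces \<open>x = y\<close>.\<close>

lemma tpair_in_gen_group:
  assumes "u \<in> H" "v \<in> H" "chi u = chi v" shows "tpair u v \<in> H"
proof -
  obtain x where x: "tpair u x \<in> H" "x \<in> {id, b r}" using section_pairs[OF assms(1)] by blast
  obtain y where y: "tpair v y \<in> H" "y \<in> {id, b r}" using section_pairs[OF assms(2)] by blast
  have "chi x = chi y" using x(1) y(1) assms(3) tpair_in_gen_group_imp(3) by metis
  moreover have "chi (b r)" using level_parity_b r by simp
  ultimately have "x = y" using x(2) y(2) by auto
  have xx: "tpair x x \<in> H" "x \<circ> x = id" using x(2) br_involution tpair_br_br by (auto simp: tpair_id)
  have "tree_swap \<circ> tpair v x \<circ> tree_swap \<in> H" using y(1) \<open>x = y\<close> by simp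
  then have "tpair x v \<in> H" by (simp only: swap_tpair_swap)
  then have "tpair u x \<circ> tpair x x \<circ> tpair x v \<in> H" using x(1) xx(1) by simp
  moreover have "u \<circ> x \<circ> x = u" using xx(2) by (simp add: comp_assoc)
  ultimately show ?thesis using xx(2) by (simp add: tpair_comp)
qed

section \<open>Orders of the truncations\<close>

text \<open>For \<open>i \<le> r\<close> the only switch of \<open>a i\<close> is at a vertex of
  level \<open>i - 1\<close>, which moves nothing above level \<open>i\<close>.\<close>

lemma agree_a_id:
  assumes "i \<ge> 1" "i \<le> r" "n < i" shows "agree n (a i) id"
  using assms
proof (induction i arbitrary: n rule: dec_induct)
  case base
  then have "n = 0" by simp
  then show "agree n (a 1) id" by (simp add: agree_0 a_in_W)
next
  case (step i)
  have "a (Suc i) = tpair (a i) id" using step a_rec(3) by simp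
  show "agree n (a (Suc i)) id"
  proof (cases n)
    case 0
    then show ?thesis using agree_0 a_in_W id_in_W by simp
  next
    case (Suc k)
    then have "agree k (a i) id" using step.prems by (intro step.IH) auto
    then have "agree (Suc k) (tpair (a i) id) (tpair id id)" by (simp add: agree_tpair)
    then show ?thesis using \<open>a (Suc i) = tpair (a i) id\<close> Suc by (simp add: tpair_id)
  qed
qed

private definition section_images :: "nat \<Rightarrow> ((word \<Rightarrow> word) \<times> (word \<Rightarrow> word)) set" where
  "section_images n = {(W_proj n u, W_proj n v) | u v. u \<in> H \<and> v \<in> H \<and> chi u = chi v}"

text \<open>The truncations that fix the two subtrees and those that swap them form disjoint sets
  \<open>X\<close> and \<open>Y\<close>, each in bijection with the truncated pairs.\<close>

lemma card_W_proj_Suc: "card (W_proj (Suc n) ` H) = 2 * card (section_images n)"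
proof -
  define E where "E = {(u, v). u \<in> H \<and> v \<in> H \<and> chi u = chi v}"
  define X Y where "X = (\<lambda>(u, v). W_proj (Suc n) (tpair u v)) ` E"
    and "Y = (\<lambda>(u, v). W_proj (Suc n) (tpair u v \<circ> tree_swap)) ` E"
  have "W_proj (Suc n) ` H = X \<union> Y"
  proof (intro equalityI subsetI)
    fix p assume "p \<in> W_proj (Suc n) ` H"
    then obtain g where g: "g \<in> H" "p = W_proj (Suc n) g" by blast
    from g(1) show "p \<in> X \<union> Y"
    proof (cases rule: gen_group_cases)
      case (1 u v)
      then have "(u, v) \<in> E" using g(1) tpair_in_gen_group_imp unfolding E_def by blast
      then show ?thesis using 1 g(2) unfolding X_def by force
    next
      case (2 u v)
      then have "tpair u v \<in> H" using gen_group_comp[OF g(1) gen_group_swap] by (simp only: comp_swap_cancel)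
      then have "(u, v) \<in> E" using tpair_in_gen_group_imp unfolding E_def by blast
      then show ?thesis using 2 g(2) unfolding Y_def by force
    qed
  next
    fix p assume "p \<in> X \<union> Y"
    then obtain u v where "(u, v) \<in> E"
      "p = W_proj (Suc n) (tpair u v) \<or> p = W_proj (Suc n) (tpair u v \<circ> tree_swap)"
      unfolding X_def Y_def by force
    then show "p \<in> W_proj (Suc n) ` H"
      using tpair_in_gen_group gen_group_comp gen_group_swap unfolding E_def by blast
  qed
  moreover have "finite X" "finite Y"
    using finite_W_proj[of H "Suc n"] gen_group_in_W calculation by (auto intro: finite_subset)
  moreover have "X \<inter> Y = {}"
    unfolding X_def Y_def by (auto simp: W_proj_eq_iff not_agree_tpair_swap)
  moreover have "card X = card (section_images n)" "card Y = card (section_images n)"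
  proof -
    have S: "section_images n = (\<lambda>(u, v). (W_proj n u, W_proj n v)) ` E"
      unfolding section_images_def E_def by auto
    \<comment> \<open>Two maps with the same fibres on \<open>E\<close> have equipotent images. This
      compares truncated pairs with pairs of truncations.\<close>
    have fact: "card (f ` E) = card (h ` E)"
      if "\<And>x y. f x = f y \<longleftrightarrow> h x = h y"
      for f :: "(word \<Rightarrow> word) \<times> (word \<Rightarrow> word) \<Rightarrow> word \<Rightarrow> word"
        and h :: "(word \<Rightarrow> word) \<times> (word \<Rightarrow> word) \<Rightarrow> (word \<Rightarrow> word) \<times> (word \<Rightarrow> word)"
    proof (rule bij_betw_same_card)
      have "h (inv_into E f (f x)) = h x" if "x \<in> E" for x
        using \<open>\<And>x y. f x = f y \<longleftrightarrow> h x = h y\<close> f_inv_into_f[of "f x" f E] that by blast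
      then show "bij_betw (\<lambda>p. h (inv_into E f p)) (f ` E) (h ` E)"
        using that by (auto simp: bij_betw_def inj_on_def image_image)
    qed
    show "card X = card (section_images n)" "card Y = card (section_images n)"
      unfolding X_def Y_def S
      by (rule fact; auto simp: W_proj_eq_iff agree_swap_iff agree_tpair_iff)+
  qed
  ultimately show ?thesis by (simp add: card_Un_disjoint)
qed

lemma ar: "a r \<in> H" "chi (a r)" "a r \<circ> a r = id"
  using r level_parity_a a_involution by simp_all

text \<open>Below level \<open>r\<close> the constraint is invisible: \<open>a r\<close> is trivial
  there but has odd \<open>chi\<close>, so replacing \<open>v\<close> by
  \<open>v \<circ> a r\<close> repairs a mismatch.\<close>

lemma card_section_images_less:
  assumes "n < r" shows "card (section_images n) = card (W_proj n ` H) ^ 2"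
proof -
  have "W_proj n ` H \<times> W_proj n ` H \<subseteq> section_images n"
  proof clarify
    fix u v assume uv: "u \<in> H" "v \<in> H"
    show "(W_proj n u, W_proj n v) \<in> section_images n"
    proof (cases "chi u = chi v")
      case False
      have "agree n (v \<circ> a r) (v \<circ> id)"
        using assms r ar(1) by (intro agree_comp agree_a_id agree_refl gen_group_in_W) auto
      then have "W_proj n v = W_proj n (v \<circ> a r)" by (simp add: W_proj_eq_iff agree_def)
      moreover have "chi u = chi (v \<circ> a r)" using False ar uv level_parity_comp by auto
      ultimately show ?thesis using uv ar(1) gen_group_comp unfolding section_images_def by blast
    qed (use uv in \<open>auto simp: section_images_def\<close>)
  qed
  moreover have "section_images n \<subseteq> W_proj n ` H \<times> W_proj n ` H"
    unfolding section_images_def by auto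
  ultimately have "section_images n = W_proj n ` H \<times> W_proj n ` H" by blast
  then show ?thesis by (simp add: card_cartesian_product power2_eq_square)
qed

text \<open>From level \<open>r\<close> on, a truncation determines \<open>chi\<close>. The two
  values of \<open>chi\<close> split the truncations into halves of equal size k, so the admissible
  pairs number 2k^2, against (2k)^2 in all.\<close>

lemma card_section_images_ge:
  assumes "n \<ge> r" shows "2 * card (section_images n) = card (W_proj n ` H) ^ 2"
proof -
  define K where "K e = W_proj n ` {u \<in> H. chi u = e}" for e
  have agree_chi: "chi u = chi v" if "agree n u v" for u v
    using that assms r level_parity_agree[of "r - 1" u v] by (simp add: agree_def)
  have disj: "K True \<inter> K False = {}"
    unfolding K_def using agree_chi by (auto simp: W_proj_eq_iff)
  have fin: "finite (K e)" for e
    unfolding K_def using gen_group_in_W by (intro finite_W_proj) auto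
  have card_K: "card (K True) = card (K False)"
  proof (rule bij_betw_same_card)
    \<comment> \<open>Right multiplication by \<open>a r\<close> flips \<open>chi\<close>. It
      descends to truncations because \<open>a r\<close> preserves lengths, and it is its own
      inverse.\<close>
    define f where "f p = restrict (p \<circ> a r) (trunc_tree n)" for p :: "word \<Rightarrow> word"
    have "length (a r t) = length t" for t using length_W gen_group_in_W ar(1) by blast
    then have f: "f (W_proj n u) = W_proj n (u \<circ> a r)" for u
      unfolding f_def W_proj_def by (auto simp: trunc_tree_def fun_eq_iff)
    have cancel: "u \<circ> a r \<circ> a r = u" for u using ar(3) by (simp add: comp_assoc)
    have fK: "f p \<in> K (\<not> e)" if pK: "p \<in> K e" for p e
    proof -
      obtain u where u: "u \<in> H" "chi u = e" "p = W_proj n u" using pK unfolding K_def by blast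
      then have "u \<circ> a r \<in> H" "chi (u \<circ> a r) = (\<not> e)" using ar level_parity_comp by auto
      then show ?thesis unfolding K_def u(3) f by blast
    qed
    have ff: "f (f p) = p" if "p \<in> K e" for p e
      using that unfolding K_def by (auto simp: f cancel)
    show "bij_betw f (K True) (K False)"
      by (rule bij_betw_byWitness[where f' = f]) (use fK ff in force)+
  qed
  have "W_proj n ` H = K True \<union> K False" unfolding K_def by blast
  then have "card (W_proj n ` H) = 2 * card (K True)"
    using disj fin card_K by (simp add: card_Un_disjoint)
  moreover have "section_images n = K True \<times> K True \<union> K False \<times> K False"
    unfolding section_images_def K_def by auto
  then have "card (section_images n) = 2 * card (K True) ^ 2"
    using disj fin card_K
    by (simp add: card_Un_disjoint Times_Int_Times card_cartesian_product power2_eq_square)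
  ultimately show ?thesis by (simp add: power2_eq_square)
qed

text \<open>The factor 2 turns the recursion c' = 2 c^2 into plain squaring. The resulting order
  2^(2^n - 1) is that of the full automorphism group of the truncated tree.\<close>

lemma card_W_proj_le: "n \<le> r \<Longrightarrow> 2 * card (W_proj n ` H) = 2 ^ (2 ^ n)"
proof (induction n)
  case 0
  have "W_proj 0 ` H = {W_proj 0 id}"
  proof
    show "W_proj 0 ` H \<subseteq> {W_proj 0 id}"
      using agree_0 gen_group_in_W by (auto simp: W_proj_eq_iff)
  qed simp
  then show ?case by simp
next
  case (Suc n)
  then have "n < r" by simp
  then have "2 * card (W_proj (Suc n) ` H) = (2 * card (W_proj n ` H)) ^ 2"
    by (simp add: card_W_proj_Suc card_section_images_less power_mult_distrib)
  also have "\<dots> = 2 ^ (2 ^ Suc n)" using Suc by (simp add: square_two_power del: power_Suc)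
  finally show ?case .
qed

text \<open>Here the order is simply squared at each step, as are the two powers of 2. At
  \<open>n = r\<close> the left factor is 2, which matches \<open>card_W_proj_le\<close>.\<close>

lemma card_W_proj_ge:
  assumes "n \<ge> r" shows "2 ^ (2 ^ (n - r)) * card (W_proj n ` H) = 2 ^ (2 ^ n)"
  using assms
proof (induction n rule: dec_induct)
  case base
  show ?case using card_W_proj_le[of r] by simp
next
  case (step n)
  have "2 ^ (2 ^ (Suc n - r)) * card (W_proj (Suc n) ` H)
      = (2 ^ (2 ^ (n - r)))\<^sup>2 * (card (W_proj n ` H))\<^sup>2"
    using step(1) card_section_images_ge
    by (simp add: card_W_proj_Suc square_two_power Suc_diff_le del: power_Suc)
  also have "\<dots> = (2 ^ (2 ^ n))\<^sup>2" by (simp only: power_mult_distrib[symmetric] step.IH)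
  also have "\<dots> = 2 ^ (2 ^ Suc n)" by (rule square_two_power)
  finally show ?case .
qed

section \<open>Logarithms and the limit\<close>

lemma log_card_W_proj_G:
  assumes "n \<ge> r"
  shows "log 2 (real (card (W_proj n ` G r))) = (1 - 1 / 2 ^ r) * 2 ^ n"
proof -
  define c where "c = card (W_proj n ` H)"
  have "real (2 ^ (2 ^ (n - r)) * c) = real (2 ^ (2 ^ n))"
    by (simp only: card_W_proj_ge[OF assms] c_def)
  then have eq: "(2::real) ^ (2 ^ (n - r)) * real c = 2 ^ (2 ^ n)"
    by (simp only: of_nat_mult of_nat_power of_nat_numeral)
  then have "c \<noteq> 0" by (intro notI) simp
  then have "log 2 ((2::real) ^ (2 ^ (n - r)) * real c) = real (2 ^ (n - r)) + log 2 (real c)"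
    by (subst log_mult) (simp_all only: log_pow_cancel, simp_all)
  then have "real (2 ^ (n - r)) + log 2 (real c) = real (2 ^ n)"
    unfolding eq by (subst (asm) log_pow_cancel) simp_all
  moreover have "real (2 ^ (n - r)) = 2 ^ n / 2 ^ r"
    unfolding of_nat_power of_nat_numeral using assms by (simp add: power_diff)
  ultimately have "log 2 (real c) = (1 - 1 / 2 ^ r) * 2 ^ n" by (simp add: left_diff_distrib)
  moreover have "W_proj n ` G r = W_proj n ` H" using W_proj_G gen_group_in_W by blast
  ultimately show ?thesis by (simp only: c_def)
qed

end

theorem theorem4p4p2:
  fixes r :: nat
  assumes "r \<ge> 1"
  shows "has_hausdorff_dim (G r) (1 - 1 / 2 ^ r)"
proof -
  define d :: real where "d = 1 - 1 / 2 ^ r"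
  have "(\<lambda>n. d / (1 - (1 / 2) ^ n)) \<longlonglongrightarrow> d / (1 - 0)"
    by (intro tendsto_intros LIMSEQ_realpow_zero) auto
  \<comment> \<open>At \<open>n = 0\<close> both sides divide by zero and are 0, so the identity
    holds for every \<open>n\<close>.\<close>
  moreover have "d / (1 - (1 / 2) ^ n) = d * 2 ^ n / (2 ^ n - 1)" for n :: nat
  proof -
    have "1 - (1 / 2) ^ n = (2 ^ n - 1) / (2 ^ n :: real)"
      by (simp add: power_one_over diff_divide_distrib)
    then show ?thesis by simp
  qed
  ultimately have "(\<lambda>n. d * 2 ^ n / (2 ^ n - 1)) \<longlonglongrightarrow> d" by simp
  moreover have "eventually (\<lambda>n. d * 2 ^ n / (2 ^ n - 1)
      = log 2 (real (card (W_proj n ` G r))) / (2 ^ n - 1)) sequentially"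
    using eventually_ge_at_top[of r]
    by eventually_elim (simp add: log_card_W_proj_G[OF assms] d_def)
  ultimately show ?thesis
    unfolding has_hausdorff_dim_def d_def[symmetric] by (rule Lim_transform_eventually)
qed

end
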